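(* There is a sub-linear compression algorithm (sub-linear in the number $p$ of model parameters) that compresses per-sample gradients in $\mathbb{R}^p$ to vectors in $\mathbb{R}^k$ with a complexity of $O(k')$ per sample, where $k<k'\ll p$. Moreover, this extends to linear layers, where the gradients are never materialized.
   Context: Setting. In gradient-based data attribution one has a trained model with $p$ parameters, and for each data sample $z_i$ the per-sample gradient $g_i\in\mathbb{R}^p$ of the loss at $z_i$ with respect to the parameters. A compression algorithm maps each $g_i$ to a vector $\hat g_i\in\mathbb{R}^k$, where $k\ll p$ is the target compression dimension. Complexity means the (time and space) cost of compressing. The intermediate dimension $k'$ is a tunable hyperparameter. The theorem is a summary of the following two algorithms. General algorithm (GraSS), written $\mathrm{SJLT}_k\circ\mathrm{Mask}_{k'}$. (1) Sparsification: $\mathrm{Mask}_{k'}$ extracts from $g\in\mathbb{R}^p$ the sub-vector $g'\in\mathbb{R}^{k'}$ indexed by $k'$ distinct coordinates, selected beforehand either at random or by a one-time optimization; cost $O(k')$. (2) Sparse projection: $\mathrm{SJLT}_k$, the sparse Johnson-Lindenstrauss transform with one nonzero entry ($\pm1$, at a random position) in each column of its projection matrix, maps $g'$ to $\hat g\in\mathbb{R}^k$: each coordinate of $g'$ is added to or subtracted from one randomly chosen coordinate of $\hat g$; cost $O(k')$. The overall cost is $O(k')$. Linear layers (FactGraSS). Consider $L$ linear layers, the $l$-th with weight $W_l\in\mathbb{R}^{d_l^{\mathrm{out}}\times d_l^{\mathrm{in}}}$ and $p_l=d_l^{\mathrm{in}}d_l^{\mathrm{out}}$ parameters, $p=\sum_l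 p_l$. For a sample that is a sequence of length $T$, let $x_l\in\mathbb{R}^{d_l^{\mathrm{in}}\times T}$ be the input of layer $l$ (from the forward pass) and $y_l\in\mathbb{R}^{d_l^{\mathrm{out}}\times T}$ the gradient of the loss with respect to the pre-activation output of layer $l$ (from the backward pass). The vectorized gradient with respect to $W_l$ is $\sum_{t=1}^T (x_l)_{:t}\otimes (y_l)_{:t}\in\mathbb{R}^{p_l}$, where $(\cdot)_{:t}$ is the $t$-th column and $\otimes$ the Kronecker product. Given target dimensions $k_l=k_l^{\mathrm{in}}k_l^{\mathrm{out}}\ll p_l$ and intermediate dimensions $k_l^{\mathrm{in}}\le {k_l^{\mathrm{in}}}'\ll d_l^{\mathrm{in}}$, $k_l^{\mathrm{out}}\le {k_l^{\mathrm{out}}}'\ll d_l^{\mathrm{out}}$, with $k_l'={k_l^{\mathrm{in}}}'{k_l^{\mathrm{out}}}'$, the algorithm (1) masks $x_l$ and $y_l$ to ${k_l^{\mathrm{in}}}'$ and ${k_l^{\mathrm{out}}}'$ coordinates respectively, (2) forms from the masked factors, via the same Kronecker-product formula, a sparsified gradient of dimension $k_l'$, and (3) applies $\mathrm{SJLT}_{k_l}$ to it to obtain a vector of dimension $k_l$. The cost is accounted as $O({k_l^{\mathrm{in}}}')$ and $O({k_l^{\mathrm{out}}}')$ for masking, $O(k_l')$ for the Kronecker product of two vectors of sizes ${k_l^{\mathrm{in}}}'$ and ${k_l^{\mathrm{out}}}'$, and $O(k_l')$ for the sparse projection, that is, $O(k_l')$ for layer $l$ and $O(k')$ in total with $k=\sum_l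 k_l$ and $k'=\sum_l k_l'$. "Never materialized" means that the full layer gradient in $\mathbb{R}^{p_l}$ is never formed. *)

theory Defs
  imports
    "HOL-Probability.Probability_Mass_Function"
    "HOL-Library.Landau_Symbols"
    "Jordan_Normal_Form.Matrix"
begin

hide_const (open) Finite_Cartesian_Product.vec Finite_Cartesian_Product.mat
  Finite_Cartesian_Product.row Finite_Cartesian_Product.column
  Finite_Cartesian_Product.vec_nth Finite_Cartesian_Product.vec_lambda
hide_type (open) Finite_Cartesian_Product.vec
no_notation Finite_Cartesian_Product.vec_nth (infixl \<open>$\<close> 90)

section \<open>The compression maps\<close>

text \<open>A mask is the list of the selected coordinates; the intermediate dimension is its length.\<close>

definition Mask :: "nat list \<Rightarrow> real vec \<Rightarrow> real vec" where
  "Mask ms g = vec (length ms) (\<lambda>i. g $ (ms ! i))"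

definition is_mask :: "nat list \<Rightarrow> nat \<Rightarrow> bool" where
  "is_mask ms d \<longleftrightarrow> distinct ms \<and> set ms \<subseteq> {..<d}"

definition sjlt_matrices :: "nat \<Rightarrow> nat \<Rightarrow> real mat set" where
  "sjlt_matrices k k' = {A \<in> carrier_mat k k'.
     \<forall>j<k'. \<exists>i<k. A $$ (i, j) \<in> {1, -1} \<and> (\<forall>i'<k. i' \<noteq> i \<longrightarrow> A $$ (i', j) = 0)}"

text \<open>The uniform distribution on these matrices is the same as choosing, independently for each
  column, a uniform position and a uniform sign.\<close>

definition SJLT :: "nat \<Rightarrow> nat \<Rightarrow> real mat pmf" where
  "SJLT k k' = pmf_of_set (sjlt_matrices k k')"

definition sjlt_row :: "real mat \<Rightarrow> nat \<Rightarrow> nat" where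
  "sjlt_row A j = (THE i. i < dim_row A \<and> A $$ (i, j) \<noteq> 0)"

definition sjlt_sign :: "real mat \<Rightarrow> nat \<Rightarrow> real" where
  "sjlt_sign A j = A $$ (sjlt_row A j, j)"

definition kron_vec :: "real vec \<Rightarrow> real vec \<Rightarrow> real vec" (infixl \<open>\<otimes>\<^sub>v\<close> 70) where
  "u \<otimes>\<^sub>v v = vec (dim_vec u * dim_vec v) (\<lambda>r. u $ (r div dim_vec v) * v $ (r mod dim_vec v))"

text \<open>The vectorized gradient of a linear layer with respect to its weight; the columns of \<open>X\<close>
  (layer inputs) and \<open>Y\<close> (gradients of the pre-activations) are indexed by the sequence.\<close>

definition layer_grad :: "real mat \<Rightarrow> real mat \<Rightarrow> real vec" where
  "layer_grad X Y = vec (dim_row X * dim_row Y)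
     (\<lambda>r. \<Sum>t<dim_col X. (col X t \<otimes>\<^sub>v col Y t) $ r)"

definition mask_rows :: "nat list \<Rightarrow> real mat \<Rightarrow> real mat" where
  "mask_rows ms X = mat (length ms) (dim_col X) (\<lambda>(i, t). X $$ (ms ! i, t))"

text \<open>The coordinates of the Kronecker product \<open>u \<otimes>\<^sub>v v\<close>, with \<open>v\<close> of dimension \<open>d\<close>, that belong to
  the masked factors.\<close>

definition kron_mask :: "nat list \<Rightarrow> nat list \<Rightarrow> nat \<Rightarrow> nat list" where
  "kron_mask ms ns d = concat (map (\<lambda>i. map (\<lambda>j. i * d + j) ns) ms)"

text \<open>The data of the two algorithms that are fixed before any sample is compressed.\<close>

record grass =
  param_dim :: nat
  out_dim :: nat
  coords :: "nat list"
  proj :: "real mat"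

abbreviation mid_dim :: "grass \<Rightarrow> nat" where
  "mid_dim G \<equiv> length (coords G)"

definition grass_setup :: "grass \<Rightarrow> bool" where
  "grass_setup G \<longleftrightarrow> 0 < out_dim G \<and> out_dim G < mid_dim G \<and> mid_dim G < param_dim G \<and>
     is_mask (coords G) (param_dim G) \<and> proj G \<in> set_pmf (SJLT (out_dim G) (mid_dim G))"

definition GraSS :: "grass \<Rightarrow> real vec \<Rightarrow> real vec" where
  "GraSS G g = proj G *\<^sub>v Mask (coords G) g"

record layer =
  d_in :: nat
  d_out :: nat
  k_in :: nat
  k_out :: nat
  coords_in :: "nat list"
  coords_out :: "nat list"
  lproj :: "real mat"

definition layer_p :: "layer \<Rightarrow> nat" where "layer_p F = d_in F * d_out F"
definition layer_k :: "layer \<Rightarrow> nat" where "layer_k F = k_in F * k_out F"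
definition layer_mid :: "layer \<Rightarrow> nat" where
  "layer_mid F = length (coords_in F) * length (coords_out F)"

definition layer_setup :: "layer \<Rightarrow> bool" where
  "layer_setup F \<longleftrightarrow>
     0 < k_in F \<and> k_in F \<le> length (coords_in F) \<and> length (coords_in F) < d_in F \<and>
     0 < k_out F \<and> k_out F \<le> length (coords_out F) \<and> length (coords_out F) < d_out F \<and>
     is_mask (coords_in F) (d_in F) \<and> is_mask (coords_out F) (d_out F) \<and>
     lproj F \<in> set_pmf (SJLT (layer_k F) (layer_mid F))"

definition FactGraSS :: "layer \<Rightarrow> real mat \<Rightarrow> real mat \<Rightarrow> real vec" where
  "FactGraSS F X Y = lproj F *\<^sub>v
     layer_grad (mask_rows (coords_in F) X) (mask_rows (coords_out F) Y)"

definition layers_setup :: "layer list \<Rightarrow> bool" where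
  "layers_setup Fs \<longleftrightarrow> Fs \<noteq> [] \<and> (\<forall>F\<in>set Fs. layer_setup F)"

definition total_p :: "layer list \<Rightarrow> nat" where "total_p Fs = (\<Sum>F\<leftarrow>Fs. layer_p F)"
definition total_mid :: "layer list \<Rightarrow> nat" where "total_mid Fs = (\<Sum>F\<leftarrow>Fs. layer_mid F)"

text \<open>A sample of sequence length \<open>T\<close> is given by the pair of factors of each layer.\<close>

definition layer_samples :: "layer list \<Rightarrow> nat \<Rightarrow> (nat \<Rightarrow> real mat \<times> real mat) set" where
  "layer_samples Fs T = {z. \<forall>l<length Fs.
     fst (z l) \<in> carrier_mat (d_in (Fs ! l)) T \<and> snd (z l) \<in> carrier_mat (d_out (Fs ! l)) T}"

section \<open>Cost model\<close>

text \<open>A unit-cost real random access machine with structured programs. The input consists of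
  read-only tables of naturals (named by \<open>'i\<close>) and of reals (named by \<open>'r\<close>), with random access.
  The working memory consists of index registers and of arrays of reals, addressed by a name and a
  list of index registers; it is empty at the start, and an unwritten cell has no specified content.
  Control flow and addresses depend on the tables of naturals only. Since programs are finite and do
  not depend on the input, the length of an index list is a constant.\<close>

type_synonym reg = string

datatype 'r operand = Input 'r "reg list" | Cell string "reg list"

datatype ('i, 'r) com =
    ISet reg nat
  | IAdd reg reg reg
  | ILoad reg 'i "reg list"
  | RSet string "reg list" real
  | RMove string "reg list" "'r operand"
  | RAdd string "reg list" "'r operand" "'r operand"
  | RSub string "reg list" "'r operand" "'r operand"
  | RMul string "reg list" "'r operand" "'r operand"
  | Seq "('i, 'r) com" "('i, 'r) com"
  | For reg reg "('i, 'r) com"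

record state =
  ireg :: "reg \<rightharpoonup> nat"
  mem :: "string \<times> nat list \<rightharpoonup> real"

record ('i, 'r) tables =
  itab :: "'i \<Rightarrow> nat list \<Rightarrow> nat"
  rtab :: "'r \<Rightarrow> nat list \<Rightarrow> real"

definition start :: state where
  "start = \<lparr>ireg = Map.empty, mem = Map.empty\<rparr>"

definition ival :: "state \<Rightarrow> reg \<Rightarrow> nat" where
  "ival s r = the (ireg s r)"

fun rval :: "('i, 'r) tables \<Rightarrow> state \<Rightarrow> 'r operand \<Rightarrow> real" where
  "rval E s (Input a rs) = rtab E a (map (ival s) rs)"
| "rval E s (Cell a rs) = the (mem s (a, map (ival s) rs))"

definition iwrite :: "reg \<Rightarrow> nat \<Rightarrow> state \<Rightarrow> state" where
  "iwrite r n s = s\<lparr>ireg := (ireg s)(r \<mapsto> n)\<rparr>"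

definition rwrite :: "string \<Rightarrow> reg list \<Rightarrow> real \<Rightarrow> state \<Rightarrow> state" where
  "rwrite a rs x s = s\<lparr>mem := (mem s)((a, map (ival s) rs) \<mapsto> x)\<rparr>"

text \<open>\<open>exec E c s\<close> lists the states after each elementary step. \<open>For r b c\<close> runs \<open>c\<close> with \<open>r\<close> set to
  \<open>0, 1, \<dots>\<close> below the value of \<open>b\<close> at loop entry; entering the loop costs one step, as does each
  update of \<open>r\<close>.\<close>

primrec exec :: "('i, 'r) tables \<Rightarrow> ('i, 'r) com \<Rightarrow> state \<Rightarrow> state list" where
  "exec E (ISet r n) s = [iwrite r n s]"
| "exec E (IAdd r a b) s = [iwrite r (ival s a + ival s b) s]"
| "exec E (ILoad r a rs) s = [iwrite r (itab E a (map (ival s) rs)) s]"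
| "exec E (RSet a rs x) s = [rwrite a rs x s]"
| "exec E (RMove a rs u) s = [rwrite a rs (rval E s u) s]"
| "exec E (RAdd a rs u v) s = [rwrite a rs (rval E s u + rval E s v) s]"
| "exec E (RSub a rs u v) s = [rwrite a rs (rval E s u - rval E s v) s]"
| "exec E (RMul a rs u v) s = [rwrite a rs (rval E s u * rval E s v) s]"
| "exec E (Seq c c') s = (let tr = exec E c s in tr @ exec E c' (last tr))"
| "exec E (For r b c) s =
     foldl (\<lambda>tr n. let s' = iwrite r n (last tr) in tr @ s' # exec E c s') [s] [0..<ival s b]"

abbreviation trace :: "('i, 'r) com \<Rightarrow> ('i, 'r) tables \<Rightarrow> state list" where
  "trace P E \<equiv> exec E P start"

definition run_time :: "('i, 'r) com \<Rightarrow> ('i, 'r) tables \<Rightarrow> nat" where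
  "run_time P E = length (trace P E)"

text \<open>Space is the peak number of registers and cells in use. The read-only tables are not part of
  the per-sample cost.\<close>

definition run_space :: "('i, 'r) com \<Rightarrow> ('i, 'r) tables \<Rightarrow> nat" where
  "run_space P E =
     Max ((\<lambda>s. card (dom (ireg s)) + card (dom (mem s))) ` set (trace P E))"

text \<open>\<open>outputs P E is v\<close>: at the end, the part of the array \<open>out\<close> with leading indices \<open>is\<close> contains
  the vector \<open>v\<close>.\<close>

definition outputs :: "('i, 'r) com \<Rightarrow> ('i, 'r) tables \<Rightarrow> nat list \<Rightarrow> real vec \<Rightarrow> bool" where
  "outputs P E is v \<longleftrightarrow>
     (\<forall>i<dim_vec v. mem (last (trace P E)) (''out'', is @ [i]) = Some (v $ i))"

text \<open>A program materializes a vector \<open>v z\<close> of dimension \<open>d\<close> depending on the sample \<open>z\<close> if, at some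
  step, \<open>d\<close> distinct working cells hold its entries. The step and the cells are the same for all
  samples: on this machine they cannot depend on real data, and a coincidence of values for a single
  sample (for instance if everything is zero) must not count.\<close>

definition materializes ::
  "('i, 'r) com \<Rightarrow> ('z \<Rightarrow> ('i, 'r) tables) \<Rightarrow> 'z set \<Rightarrow> nat \<Rightarrow> ('z \<Rightarrow> real vec) \<Rightarrow> bool" where
  "materializes P E Z d v \<longleftrightarrow>
     (\<exists>n \<sigma>. inj_on \<sigma> {..<d} \<and>
        (\<forall>z\<in>Z. n < length (trace P (E z)) \<and>
           (\<forall>j<d. mem (trace P (E z) ! n) (\<sigma> j) = Some (v z $ j))))"

section \<open>Input tables\<close>

text \<open>The projection matrix is passed by the row and the sign of the nonzero entry of each column.\<close>

datatype grass_itab = Param_dim | Out_dim | Mid_dim | Coord | Row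
datatype grass_rtab = Grad | Sign

fun grass_index :: "grass \<Rightarrow> grass_itab \<Rightarrow> nat list \<Rightarrow> nat" where
  "grass_index G Param_dim [] = param_dim G"
| "grass_index G Out_dim [] = out_dim G"
| "grass_index G Mid_dim [] = mid_dim G"
| "grass_index G Coord [i] = (if i < mid_dim G then coords G ! i else 0)"
| "grass_index G Row [j] = (if j < mid_dim G then sjlt_row (proj G) j else 0)"
| "grass_index _ _ _ = 0"

fun grass_real :: "grass \<Rightarrow> real vec \<Rightarrow> grass_rtab \<Rightarrow> nat list \<Rightarrow> real" where
  "grass_real G g Grad [i] = (if i < param_dim G then g $ i else 0)"
| "grass_real G g Sign [j] = (if j < mid_dim G then sjlt_sign (proj G) j else 0)"
| "grass_real _ _ _ _ = 0"

definition grass_tables :: "grass \<Rightarrow> real vec \<Rightarrow> (grass_itab, grass_rtab) tables" where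
  "grass_tables G g = \<lparr>itab = grass_index G, rtab = grass_real G g\<rparr>"

datatype layer_itab = Layers | Seq_len | D_in | D_out | K_in | K_out | K | Mid_in | Mid_out | Mid
  | Coord_in | Coord_out | LRow
datatype layer_rtab = X_in | Y_out | LSign

text \<open>The first index of every table, except for the number of layers and the sequence length, is the
  layer.\<close>

fun layer_index :: "layer list \<Rightarrow> nat \<Rightarrow> layer_itab \<Rightarrow> nat list \<Rightarrow> nat" where
  "layer_index Fs T Layers [] = length Fs"
| "layer_index Fs T Seq_len [] = T"
| "layer_index Fs T a (l # is) = (if l < length Fs then
     (let F = Fs ! l in
      case (a, is) of
        (D_in, []) \<Rightarrow> d_in F
      | (D_out, []) \<Rightarrow> d_out F
      | (K_in, []) \<Rightarrow> k_in F
      | (K_out, []) \<Rightarrow> k_out F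
      | (K, []) \<Rightarrow> layer_k F
      | (Mid_in, []) \<Rightarrow> length (coords_in F)
      | (Mid_out, []) \<Rightarrow> length (coords_out F)
      | (Mid, []) \<Rightarrow> layer_mid F
      | (Coord_in, [i]) \<Rightarrow> if i < length (coords_in F) then coords_in F ! i else 0
      | (Coord_out, [j]) \<Rightarrow> if j < length (coords_out F) then coords_out F ! j else 0
      | (LRow, [j]) \<Rightarrow> if j < layer_mid F then sjlt_row (lproj F) j else 0
      | _ \<Rightarrow> 0)
     else 0)"
| "layer_index _ _ _ _ = 0"

fun layer_real ::
  "layer list \<Rightarrow> nat \<Rightarrow> (nat \<Rightarrow> real mat \<times> real mat) \<Rightarrow> layer_rtab \<Rightarrow> nat list \<Rightarrow> real" where
  "layer_real Fs T z X_in [l, i, t] =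
     (if l < length Fs \<and> i < d_in (Fs ! l) \<and> t < T then fst (z l) $$ (i, t) else 0)"
| "layer_real Fs T z Y_out [l, j, t] =
     (if l < length Fs \<and> j < d_out (Fs ! l) \<and> t < T then snd (z l) $$ (j, t) else 0)"
| "layer_real Fs T z LSign [l, j] =
     (if l < length Fs \<and> j < layer_mid (Fs ! l) then sjlt_sign (lproj (Fs ! l)) j else 0)"
| "layer_real _ _ _ _ _ = 0"

definition layer_tables ::
  "layer list \<Rightarrow> nat \<Rightarrow> (nat \<Rightarrow> real mat \<times> real mat) \<Rightarrow> (layer_itab, layer_rtab) tables" where
  "layer_tables Fs T z = \<lparr>itab = layer_index Fs T, rtab = layer_real Fs T z\<rparr>"

end

theory Submission
  imports Defs
begin

text \<open>The projection has a single nonzero entry per column, so a program can treat the masked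
  coordinates one at a time, adding each, with its sign, to one cell of the output; the first \<open>j\<close>
  steps compute the product with the first \<open>j\<close> columns. For a linear layer, the coordinates of the
  sparsified gradient are indexed by pairs of masked coordinates of the two factors; each of them is
  a sum over the sequence, computed in a single accumulator and projected at once, so the space does
  not depend on the sequence length. A program that reads only masked coordinates has the same trace
  on two samples that differ outside the mask. As the full gradient tells such samples apart, no
  fixed set of cells can hold it.\<close>

section \<open>Program logic\<close>

abbreviation seq (infixr \<open>;;\<close> 60) where
  "c ;; c' \<equiv> Seq c c'"

text \<open>Running two inputs side by side lets one derivation give both the result of a program and its
  independence of the entries in which the inputs differ.\<close>

definition runs ::
  "('i, 'r) tables \<Rightarrow> ('i, 'r) tables \<Rightarrow> ('i, 'r) com \<Rightarrow> state \<Rightarrow> nat \<Rightarrow> (state \<Rightarrow> bool) \<Rightarrow> bool" where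
  "runs E E' c s N Q \<longleftrightarrow> exec E c s = exec E' c s \<and> exec E c s \<noteq> [] \<and>
     length (exec E c s) \<le> N \<and> Q (last (exec E c s))"

section \<open>Rules for single instructions, sequences and loops\<close>

lemma ival_iwrite [simp]: "ival (iwrite r n s) q = (if q = r then n else ival s q)"
  by (simp add: ival_def iwrite_def)

lemma ival_rwrite [simp]: "ival (rwrite a rs x s) = ival s"
  by (simp add: ival_def rwrite_def fun_eq_iff)

lemma mem_iwrite [simp]: "mem (iwrite r n s) = mem s"
  by (simp add: iwrite_def)

lemma mem_rwrite [simp]: "mem (rwrite a rs x s) = (mem s)((a, map (ival s) rs) \<mapsto> x)"
  by (simp add: rwrite_def)

lemma runs_weaken: "runs E E' c s N Q \<Longrightarrow> N \<le> N' \<Longrightarrow> (\<And>s. Q s \<Longrightarrow> Q' s) \<Longrightarrow> runs E E' c s N' Q'"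
  by (auto simp: runs_def)

lemma runs_ISet: "Q (iwrite r n s) \<Longrightarrow> runs E E' (ISet r n) s 1 Q"
  by (simp add: runs_def)

lemma runs_IAdd: "Q (iwrite r (ival s a + ival s b) s) \<Longrightarrow> runs E E' (IAdd r a b) s 1 Q"
  by (simp add: runs_def)

lemma runs_ILoad:
  "itab E = itab E' \<Longrightarrow> Q (iwrite r (itab E a (map (ival s) rs)) s) \<Longrightarrow>
   runs E E' (ILoad r a rs) s 1 Q"
  by (simp add: runs_def)

lemma runs_RSet: "Q (rwrite a rs x s) \<Longrightarrow> runs E E' (RSet a rs x) s 1 Q"
  by (simp add: runs_def)

lemma runs_RAdd:
  "rval E s u = rval E' s u \<Longrightarrow> rval E s v = rval E' s v \<Longrightarrow>
   Q (rwrite a rs (rval E s u + rval E s v) s) \<Longrightarrow> runs E E' (RAdd a rs u v) s 1 Q"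
  by (simp add: runs_def)

lemma runs_RMul:
  "rval E s u = rval E' s u \<Longrightarrow> rval E s v = rval E' s v \<Longrightarrow>
   Q (rwrite a rs (rval E s u * rval E s v) s) \<Longrightarrow> runs E E' (RMul a rs u v) s 1 Q"
  by (simp add: runs_def)

lemma runs_Seq:
  "runs E E' c s N (\<lambda>s'. runs E E' c' s' N' Q) \<Longrightarrow> runs E E' (c ;; c') s (N + N') Q"
  by (auto simp: runs_def Let_def)

text \<open>\<open>J n\<close> describes the state between iterations, before \<open>r\<close>
  receives \<open>n\<close>; hence the body is entered in \<open>iwrite r n s'\<close>. The bound is
  read once, at entry, from the common state, so both runs iterate equally often and the body may
  overwrite \<open>b\<close>. The budget \<open>N n\<close> may vary with \<open>n\<close> because
  layers differ in size; each summand 1 pays for an update of \<open>r\<close>, the leading 1 for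
  entering the loop.\<close>

lemma runs_For:
  assumes m: "ival s b = m" and "J 0 s"
    and step: "\<And>n s'. n < m \<Longrightarrow> J n s' \<Longrightarrow> runs E E' c (iwrite r n s') (N n) (J (Suc n))"
  shows "runs E E' (For r b c) s (1 + (\<Sum>n<m. 1 + N n)) (J m)"
proof -
  \<comment> \<open>The number of iterations is detached from \<open>ival s b\<close>, so that
    induction on it is possible.\<close>
  define tr where "tr E m =
    foldl (\<lambda>tr n. let s' = iwrite r n (last tr) in tr @ s' # exec E c s') [s] [0..<m]"
    for E :: "('a, 'b) tables" and m
  have "tr E m' = tr E' m' \<and> tr E m' \<noteq> [] \<and> length (tr E m') \<le> 1 + (\<Sum>n<m'. 1 + N n) \<and>
    J m' (last (tr E m'))"
    if "m' \<le> m" for m'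
    using that
  proof (induction m')
    case 0
    then show ?case using assms(2) by (simp add: tr_def)
  next
    case (Suc m')
    have eq: "tr E (Suc m') = tr E m' @ iwrite r m' (last (tr E m')) # exec E c (iwrite r m' (last (tr E m')))"
      for E :: "('a, 'b) tables"
      by (simp add: tr_def Let_def)
    have IH: "tr E m' = tr E' m'" "tr E m' \<noteq> []" "length (tr E m') \<le> 1 + (\<Sum>n<m'. 1 + N n)"
      "J m' (last (tr E m'))"
      using Suc by auto
    have "runs E E' c (iwrite r m' (last (tr E m'))) (N m') (J (Suc m'))"
      using Suc.prems IH(4) by (intro step) auto
    then show ?case
      using IH(2,3) unfolding runs_def eq IH(1)[symmetric] by auto
  qed
  from this[of m] show ?thesis
    unfolding runs_def exec.simps m tr_def[symmetric] by auto
qed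

lemma runs_For_const:
  assumes "ival s b = m" "J 0 s"
    and "\<And>n s'. n < m \<Longrightarrow> J n s' \<Longrightarrow> runs E E' c (iwrite r n s') N (J (Suc n))"
  shows "runs E E' (For r b c) s (1 + m * (1 + N)) (J m)"
  using runs_For[where N = "\<lambda>_. N", OF assms] by simp

section \<open>Growth of the working memory along a run, and the space bound\<close>

definition dom_le :: "state \<Rightarrow> state \<Rightarrow> bool" where
  "dom_le s s' \<longleftrightarrow> dom (ireg s) \<subseteq> dom (ireg s') \<and> dom (mem s) \<subseteq> dom (mem s')"

lemma dom_le_refl [simp]: "dom_le s s"
  by (simp add: dom_le_def)

lemma dom_le_trans: "dom_le s s' \<Longrightarrow> dom_le s' s'' \<Longrightarrow> dom_le s s''"
  unfolding dom_le_def by blast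

lemma dom_le_iwrite [simp]: "dom_le s (iwrite r n s)"
  by (auto simp: dom_le_def iwrite_def)

lemma dom_le_rwrite [simp]: "dom_le s (rwrite a rs x s)"
  by (auto simp: dom_le_def rwrite_def)

text \<open>No instruction releases a register or a cell, so domains only grow. Recording that the
  last state dominates all earlier ones turns the peak of space into a property of the final
  state.\<close>

definition dom_chain :: "state \<Rightarrow> state list \<Rightarrow> bool" where
  "dom_chain s tr \<longleftrightarrow> tr \<noteq> [] \<and> (\<forall>s'\<in>set tr. dom_le s s' \<and> dom_le s' (last tr))"

lemma dom_chain_append:
  assumes "dom_chain s tr" "dom_chain (last tr) tr'"
  shows "dom_chain s (tr @ tr')"
proof -
  have 1: "dom_le s (last tr)" "dom_le (last tr) (last tr')"
    using assms by (auto simp: dom_chain_def)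
  have "dom_le s s' \<and> dom_le s' (last tr')" if "s' \<in> set tr \<union> set tr'" for s'
    using that assms 1 dom_le_trans[OF 1(1), of s'] dom_le_trans[OF _ 1(2), of s']
    by (auto simp: dom_chain_def)
  then show ?thesis
    using assms by (simp add: dom_chain_def)
qed

lemma dom_chain_singleton: "dom_le s s' \<Longrightarrow> dom_chain s [s']"
  by (simp add: dom_chain_def)

lemma exec_dom_chain: "dom_chain s (exec E c s)"
proof (induction c arbitrary: s)
  case (Seq c c')
  then show ?case by (simp add: Let_def dom_chain_append)
next
  case (For r b c)
  have "dom_chain s
    (foldl (\<lambda>tr n. let s' = iwrite r n (last tr) in tr @ s' # exec E c s') [s] [0..<m])" for m
  proof (induction m)
    case 0
    then show ?case by (simp add: dom_chain_singleton)
  next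
    case (Suc m)
    then show ?case
      using dom_chain_append[OF dom_chain_append[OF Suc dom_chain_singleton] For.IH]
      by (simp add: Let_def)
  qed
  then show ?case by simp
qed (simp_all add: dom_chain_singleton)

text \<open>A program names finitely many registers, so \<open>R\<close> can be chosen before the
  tables and the initial state; this uniformity makes the register count a constant. Cells admit no
  such bound, as their addresses contain index values; they are controlled by the loop invariants
  instead.\<close>

lemma exec_regs_finite:
  "\<exists>R. finite R \<and> (\<forall>E s. dom (ireg (last (exec E c s))) \<subseteq> dom (ireg s) \<union> R)"
proof (induction c)
  case (Seq c c')
  then obtain R R' where R: "finite R" "\<And>E s. dom (ireg (last (exec E c s))) \<subseteq> dom (ireg s) \<union> R"
    and R': "finite R'" "\<And>E s. dom (ireg (last (exec E c' s))) \<subseteq> dom (ireg s) \<union> R'"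
    by blast
  have "dom (ireg (last (exec E (c ;; c') s))) \<subseteq> dom (ireg s) \<union> (R \<union> R')" for E s
    using R(2)[of E s] R'(2)[of E "last (exec E c s)"] exec_dom_chain[of "last (exec E c s)" E c']
    by (simp add: Let_def dom_chain_def) blast
  then show ?case using R(1) R'(1) by (meson finite_UnI)
next
  case (For r b c)
  then obtain R where R: "finite R" "\<And>E s. dom (ireg (last (exec E c s))) \<subseteq> dom (ireg s) \<union> R"
    by blast
  define tr where "tr E s m =
    foldl (\<lambda>tr n. let s' = iwrite r n (last tr) in tr @ s' # exec E c s') [s] [0..<m]" for E s m
  have "dom (ireg (last (tr E s m))) \<subseteq> dom (ireg s) \<union> insert r R" for E s m
  proof (induction m)
    case 0
    show ?case by (auto simp: tr_def)
  next
    case (Suc m)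
    \<comment> \<open>The state in which the body starts iteration \<open>m\<close>; outside the
      body, only the loop register is written.\<close>
    define s1 where "s1 = iwrite r m (last (tr E s m))"
    have last: "last (tr E s (Suc m)) = last (exec E c s1)"
      using exec_dom_chain[of s1 E c] by (simp add: dom_chain_def tr_def s1_def Let_def)
    have "dom (ireg s1) \<subseteq> dom (ireg s) \<union> insert r R"
      using Suc by (auto simp: s1_def iwrite_def)
    then show ?case using R(2)[of E s1] unfolding last by blast
  qed
  then have "dom (ireg (last (exec E (For r b c) s))) \<subseteq> dom (ireg s) \<union> insert r R" for E s
    unfolding exec.simps tr_def .
  then show ?case using R(1) by (meson finite.insertI)
next
  case (ISet r n) show ?case by (auto intro!: exI[of _ "{r}"] simp: iwrite_def)
next
  case (IAdd r a b) show ?case by (auto intro!: exI[of _ "{r}"] simp: iwrite_def)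
next
  case (ILoad r a rs) show ?case by (auto intro!: exI[of _ "{r}"] simp: iwrite_def)
qed (auto intro!: exI[of _ "{}"] simp: rwrite_def)

lemma trace_regs_finite:
  obtains R where "finite R" "\<And>E. dom (ireg (last (trace P E))) \<subseteq> R"
proof -
  obtain R where R: "finite R" "\<And>E s. dom (ireg (last (exec E P s))) \<subseteq> dom (ireg s) \<union> R"
    using exec_regs_finite[of P] by blast
  have "dom (ireg (last (trace P E))) \<subseteq> R" for E
    using R(2)[of E start] by (simp add: start_def)
  then show thesis using that R(1) by blast
qed

lemma run_space_le:
  assumes "finite R" "dom (ireg (last (trace P E))) \<subseteq> R"
    and "finite M" "dom (mem (last (trace P E))) \<subseteq> M"
  shows "run_space P E \<le> card R + card M"
proof -
  have "card (dom (ireg s)) + card (dom (mem s)) \<le> card R + card M" if "s \<in> set (trace P E)" for s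
    using that exec_dom_chain[of start E P] assms unfolding dom_chain_def dom_le_def
    by (intro add_mono card_mono) blast+
  then show ?thesis
    using exec_dom_chain[of start E P] by (auto simp: dom_chain_def run_space_def)
qed

section \<open>Sparse projections\<close>

text \<open>\<open>pmf_of_set\<close> has the expected support for a finite nonempty set. The set is
  finite because a matrix in it is determined by its entries, which lie in {1, -1, 0}; it is
  nonempty because \<open>0 < k\<close> provides a row for the nonzero entries.\<close>

lemma set_pmf_SJLT:
  assumes "0 < k"
  shows "set_pmf (SJLT k k') = sjlt_matrices k k'"
proof -
  have "A = mat k k' (restrict (($$) A) ({..<k} \<times> {..<k'}))"
    "restrict (($$) A) ({..<k} \<times> {..<k'}) \<in> ({..<k} \<times> {..<k'}) \<rightarrow>\<^sub>E {1, -1, 0}"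
    if A: "A \<in> sjlt_matrices k k'" for A
  proof -
    show "A = mat k k' (restrict (($$) A) ({..<k} \<times> {..<k'}))"
      using A unfolding sjlt_matrices_def carrier_mat_def by (intro eq_matI) simp_all
    have "A $$ (i, j) \<in> {1, -1, 0}" if ij: "i < k" "j < k'" for i j
    proof -
      obtain i0 where "A $$ (i0, j) \<in> {1, -1}" "\<And>i'. i' < k \<Longrightarrow> i' \<noteq> i0 \<Longrightarrow> A $$ (i', j) = 0"
        using A ij(2) by (auto simp: sjlt_matrices_def)
      then show ?thesis using ij(1) by (cases "i = i0") auto
    qed
    then show "restrict (($$) A) ({..<k} \<times> {..<k'}) \<in> ({..<k} \<times> {..<k'}) \<rightarrow>\<^sub>E {1, -1, 0}"
      by (intro restrict_PiE_iff[THEN iffD2]) (simp add: split_paired_all)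
  qed
  then have "sjlt_matrices k k' \<subseteq> mat k k' ` (({..<k} \<times> {..<k'}) \<rightarrow>\<^sub>E {1, -1, 0})"
    by blast
  then have "finite (sjlt_matrices k k')"
    by (rule finite_subset) (intro finite_imageI finite_PiE; simp)
  \<comment> \<open>The witness has all its nonzero entries in row 0.\<close>
  moreover have "mat k k' (\<lambda>(i, j). if i = 0 then 1 else 0) \<in> sjlt_matrices k k'"
    using assms by (auto simp: sjlt_matrices_def intro!: exI[of _ 0])
  ultimately show ?thesis unfolding SJLT_def by (intro set_pmf_of_set) auto
qed

text \<open>Uniqueness of the nonzero entry makes the description in \<open>sjlt_row\<close> well
  defined, so the row and the sign passed to a program determine the whole column.\<close>

lemma sjlt_entries:
  assumes "A \<in> sjlt_matrices k k'" "j < k'"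
  shows "sjlt_row A j < k"
    and "i < k \<Longrightarrow> A $$ (i, j) = (if i = sjlt_row A j then sjlt_sign A j else 0)"
proof -
  obtain i0 where i0: "i0 < k" "A $$ (i0, j) \<in> {1, -1}" "\<And>i'. i' < k \<Longrightarrow> i' \<noteq> i0 \<Longrightarrow> A $$ (i', j) = 0"
    using assms by (auto simp: sjlt_matrices_def)
  have "dim_row A = k" using assms by (auto simp: sjlt_matrices_def)
  then have row: "sjlt_row A j = i0"
    unfolding sjlt_row_def using i0 by (intro the_equality) auto
  show "sjlt_row A j < k" using i0 row by simp
  show "A $$ (i, j) = (if i = sjlt_row A j then sjlt_sign A j else 0)" if "i < k"
    using that i0 by (simp add: row sjlt_sign_def)
qed

text \<open>The intended content of output cell \<open>i\<close> after \<open>n\<close> columns;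
  both programs have it as their loop invariant.\<close>

definition partial_prod :: "real mat \<Rightarrow> real vec \<Rightarrow> nat \<Rightarrow> nat \<Rightarrow> real" where
  "partial_prod A h n i = (\<Sum>j<n. A $$ (i, j) * h $ j)"

lemma partial_prod_0 [simp]: "partial_prod A h 0 i = 0"
  by (simp add: partial_prod_def)

text \<open>Column \<open>n\<close> vanishes off row \<open>sjlt_row A n\<close>, so a further
  column changes a single output entry. This is the one \<open>RAdd\<close> into \<open>out\<close>
  that the programs perform per masked coordinate.\<close>

lemma partial_prod_Suc:
  assumes "A \<in> sjlt_matrices k k'" "n < k'" "i < k"
  shows "partial_prod A h (Suc n) i =
    (if i = sjlt_row A n then partial_prod A h n i + h $ n * sjlt_sign A n else partial_prod A h n i)"
  using sjlt_entries(2)[OF assms] by (simp add: partial_prod_def)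

lemma mult_mat_vec_partial_prod:
  assumes "A \<in> sjlt_matrices k k'" "dim_vec h = k'" "i < k"
  shows "(A *\<^sub>v h) $ i = partial_prod A h k' i"
  using assms by (auto simp: sjlt_matrices_def scalar_prod_def partial_prod_def atLeast0LessThan)

section \<open>GraSS\<close>

text \<open>Zeroing comes first since an unwritten cell has no specified content. The masked vector
  is not stored: \<open>h\<close> holds one signed coordinate at a time.\<close>

definition grass_prog :: "(grass_itab, grass_rtab) com" where
  "grass_prog =
     ILoad ''m'' Mid_dim [] ;; ILoad ''k'' Out_dim [] ;;
     For ''i'' ''k'' (RSet ''out'' [''i''] 0) ;;
     For ''j'' ''m''
       (ILoad ''c'' Coord [''j''] ;; ILoad ''r'' Row [''j''] ;;
        RMul ''h'' [] (Input Grad [''c'']) (Input Sign [''j'']) ;;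
        RAdd ''out'' [''r''] (Cell ''out'' [''r'']) (Cell ''h'' []))"

lemma grass_setup_proj: "grass_setup G \<Longrightarrow> proj G \<in> sjlt_matrices (out_dim G) (mid_dim G)"
  using set_pmf_SJLT[of "out_dim G" "mid_dim G"] unfolding grass_setup_def by blast

lemma GraSS_carrier: "grass_setup G \<Longrightarrow> GraSS G g \<in> carrier_vec (out_dim G)"
  using grass_setup_proj[of G] by (intro carrier_vecI) (auto simp: GraSS_def sjlt_matrices_def)

lemma grass_prog_runs:
  fixes g :: "real vec"
  assumes "grass_setup G"
  defines "E \<equiv> grass_tables G g" and "M \<equiv> insert (''h'', []) ((\<lambda>i. (''out'', [i])) ` {..<out_dim G})"
  shows "runs E E grass_prog start (11 * mid_dim G)
    (\<lambda>s. (\<forall>i<out_dim G. mem s (''out'', [i]) = Some (GraSS G g $ i)) \<and> dom (mem s) \<subseteq> M)"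
proof -
  define h where "h = Mask (coords G) g"
  have A: "proj G \<in> sjlt_matrices (out_dim G) (mid_dim G)"
    and dims: "0 < out_dim G" "out_dim G < mid_dim G"
    and mask: "set (coords G) \<subseteq> {..<param_dim G}"
    using assms(1) grass_setup_proj by (auto simp: grass_setup_def is_mask_def)
  \<comment> \<open>The table \<open>Grad\<close> returns the default 0 from
    \<open>param_dim G\<close> on; a mask never reaches that range.\<close>
  have coord: "coords G ! j < param_dim G" if "j < mid_dim G" for j
    using mask nth_mem[OF that] by auto
  have res: "GraSS G g $ i = partial_prod (proj G) h (mid_dim G) i" if "i < out_dim G" for i
    unfolding GraSS_def h_def using that
    by (intro mult_mat_vec_partial_prod[OF A]) (simp_all add: Mask_def)
  \<comment> \<open>\<open>J\<close> is the invariant of the projection loop, \<open>Z\<close>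
    (below) that of the zeroing loop; \<open>Z\<close> leads to \<open>J 0\<close> because a product
    with no columns is 0. Both confine memory to \<open>M\<close>, which yields the space bound.
    \<open>Z\<close> keeps register \<open>m\<close> for the next loop, whereas \<open>J\<close>
    needs no registers: the body loads what it uses.\<close>
  define J where "J n s \<longleftrightarrow>
    (\<forall>i<out_dim G. mem s (''out'', [i]) = Some (partial_prod (proj G) h n i)) \<and> dom (mem s) \<subseteq> M" for n and s :: state
  define Z where "Z n s \<longleftrightarrow>
    ival s ''m'' = mid_dim G \<and> (\<forall>i<n. mem s (''out'', [i]) = Some 0) \<and> dom (mem s) \<subseteq> M" for n and s :: state
  have zero: "runs E E (RSet ''out'' [''i''] 0) (iwrite ''i'' n s) 1 (Z (Suc n))"
    if "n < out_dim G" "Z n s" for n s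
    using that by (intro runs_RSet) (auto simp: Z_def M_def less_Suc_eq)
  have body: "runs E E
      (ILoad ''c'' Coord [''j''] ;; ILoad ''r'' Row [''j''] ;;
        RMul ''h'' [] (Input Grad [''c'']) (Input Sign [''j'']) ;;
        RAdd ''out'' [''r''] (Cell ''out'' [''r'']) (Cell ''h'' [])) (iwrite ''j'' n s) (1 + (1 + (1 + 1)))
      (J (Suc n))" if "n < mid_dim G" "J n s" for n s
    using that coord[of n] sjlt_entries(1)[OF A, of n]
    by (intro runs_Seq runs_ILoad runs_RMul runs_RAdd refl)
       (auto simp: J_def E_def grass_tables_def M_def h_def Mask_def partial_prod_Suc[OF A])
  have zeros: "runs E E (For ''i'' ''k'' (RSet ''out'' [''i''] 0)) s (1 + out_dim G * (1 + 1)) (Z (out_dim G))"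
    if "ival s ''k'' = out_dim G" "Z 0 s" for s
    using that zero by (rule runs_For_const)
  have project: "runs E E (For ''j'' ''m''
       (ILoad ''c'' Coord [''j''] ;; ILoad ''r'' Row [''j''] ;;
        RMul ''h'' [] (Input Grad [''c'']) (Input Sign [''j'']) ;;
        RAdd ''out'' [''r''] (Cell ''out'' [''r'']) (Cell ''h'' []))) s
      (1 + mid_dim G * (1 + (1 + (1 + (1 + 1))))) (J (mid_dim G))"
    if "Z (out_dim G) s" for s
    using that by (intro runs_For_const body) (auto simp: Z_def J_def)
  have "runs E E grass_prog start (1 + (1 + ((1 + out_dim G * (1 + 1)) +
      (1 + mid_dim G * (1 + (1 + (1 + (1 + 1)))))))) (J (mid_dim G))"
    unfolding grass_prog_def
    by (intro runs_Seq runs_ILoad refl runs_weaken[OF zeros order_refl] project)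
       (auto simp: Z_def E_def grass_tables_def start_def)
  \<comment> \<open>With \<open>k = out_dim G\<close> and \<open>m = mid_dim G\<close> the count is
    4 + 2k + 5m, and 0 < k < m gives at most 11m.\<close>
  then show ?thesis
    by (rule runs_weaken) (use dims res in \<open>auto simp: J_def\<close>)
qed

section \<open>FactGraSS\<close>

lemma dim_layer_grad [simp]: "dim_vec (layer_grad X Y) = dim_row X * dim_row Y"
  by (simp add: layer_grad_def)

lemma mask_rows_carrier:
  "X \<in> carrier_mat d T \<Longrightarrow> mask_rows ms X \<in> carrier_mat (length ms) T"
  by (simp add: mask_rows_def)

lemma mask_rows_index [simp]:
  "X \<in> carrier_mat d T \<Longrightarrow> i < length ms \<Longrightarrow> t < T \<Longrightarrow> mask_rows ms X $$ (i, t) = X $$ (ms ! i, t)"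
  by (simp add: mask_rows_def)

lemma pair_index_less: "a < n \<Longrightarrow> b < m \<Longrightarrow> a * m + b < n * m" for a b n m :: nat
  using mult_le_mono1[of "Suc a" n m] by simp

lemma layer_grad_index:
  assumes "X \<in> carrier_mat n T" "Y \<in> carrier_mat m T" "a < n" "b < m"
  shows "layer_grad X Y $ (a * m + b) = (\<Sum>t<T. X $$ (a, t) * Y $$ (b, t))"
  using assms pair_index_less[of a n b m] by (simp add: layer_grad_def kron_vec_def)

lemma kron_mask_Cons [simp]:
  "kron_mask (i # ms) ns d = map (\<lambda>j. i * d + j) ns @ kron_mask ms ns d"
  by (simp add: kron_mask_def)

lemma length_kron_mask [simp]: "length (kron_mask ms ns d) = length ms * length ns"
  by (induction ms) (simp_all add: kron_mask_def)

text \<open>Each entry of \<open>ms\<close> contributes a block of \<open>length ns\<close>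
  coordinates, so block \<open>a\<close>, offset \<open>b\<close> sits at the same row-major
  position as the pair in the Kronecker product of the masked factors.\<close>

lemma kron_mask_nth:
  "a < length ms \<Longrightarrow> b < length ns \<Longrightarrow>
   kron_mask ms ns d ! (a * length ns + b) = ms ! a * d + ns ! b"
proof (induction ms arbitrary: a)
  case (Cons i ms)
  then show ?case by (cases a) (simp_all add: nth_append add.assoc)
qed simp

lemma is_mask_nth: "is_mask ms d \<Longrightarrow> i < length ms \<Longrightarrow> ms ! i < d"
  using nth_mem by (fastforce simp: is_mask_def)

text \<open>Entry (a, b) of a Kronecker product involves only entry a of the first factor and entry
  b of the second, and this survives summation over the sequence. Hence masking the factors is
  itself a mask of the full gradient.\<close>

lemma layer_grad_mask_rows:
  assumes "X \<in> carrier_mat dX T" "Y \<in> carrier_mat dY T" "is_mask ms dX" "is_mask ns dY"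
  shows "layer_grad (mask_rows ms X) (mask_rows ns Y) = Mask (kron_mask ms ns dY) (layer_grad X Y)"
proof (rule eq_vecI)
  show "dim_vec (layer_grad (mask_rows ms X) (mask_rows ns Y)) =
    dim_vec (Mask (kron_mask ms ns dY) (layer_grad X Y))"
    by (simp add: Mask_def mask_rows_def)
  fix r assume "r < dim_vec (Mask (kron_mask ms ns dY) (layer_grad X Y))"
  then have r: "r < length ms * length ns" by (simp add: Mask_def)
  define a b where "a = r div length ns" and "b = r mod length ns"
  \<comment> \<open>The existence of an index \<open>r\<close> excludes an empty \<open>ns\<close>,
    so division by \<open>length ns\<close> recovers a genuine pair.\<close>
  have "0 < length ns" using r by (cases ns) auto
  then have ab: "a < length ms" "b < length ns" "r = a * length ns + b"
    using r by (auto simp: a_def b_def less_mult_imp_div_less)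
  have "layer_grad (mask_rows ms X) (mask_rows ns Y) $ r = (\<Sum>t<T. X $$ (ms ! a, t) * Y $$ (ns ! b, t))"
    unfolding ab(3) layer_grad_index[OF assms(1,2)[THEN mask_rows_carrier] ab(1,2)]
    using assms(1,2) ab(1,2) by simp
  also have "\<dots> = layer_grad X Y $ (ms ! a * dY + ns ! b)"
    using assms ab(1,2) by (intro layer_grad_index[symmetric]) (auto intro: is_mask_nth)
  also have "\<dots> = Mask (kron_mask ms ns dY) (layer_grad X Y) $ r"
    using r ab kron_mask_nth[OF ab(1,2)] by (simp add: Mask_def)
  finally show "layer_grad (mask_rows ms X) (mask_rows ns Y) $ r =
    Mask (kron_mask ms ns dY) (layer_grad X Y) $ r" .
qed

section \<open>The program for linear layers and its invariants\<close>

definition entry_prog :: "(layer_itab, layer_rtab) com" where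
  "entry_prog =
     ILoad ''cb'' Coord_out [''l'', ''b''] ;; ILoad ''r'' LRow [''l'', ''j''] ;;
     RSet ''h'' [] 0 ;;
     For ''t'' ''T''
       (RMul ''p'' [] (Input X_in [''l'', ''ca'', ''t'']) (Input Y_out [''l'', ''cb'', ''t'']) ;;
        RAdd ''h'' [] (Cell ''h'' []) (Cell ''p'' [])) ;;
     RMul ''h'' [] (Cell ''h'' []) (Input LSign [''l'', ''j'']) ;;
     RAdd ''out'' [''l'', ''r''] (Cell ''out'' [''l'', ''r'']) (Cell ''h'' []) ;;
     IAdd ''j'' ''j'' ''one''"

definition layer_prog :: "(layer_itab, layer_rtab) com" where
  "layer_prog =
     ILoad ''k'' K [''l''] ;; ILoad ''mi'' Mid_in [''l''] ;; ILoad ''mo'' Mid_out [''l''] ;;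
     ILoad ''T'' Seq_len [] ;; ISet ''one'' 1 ;; ISet ''j'' 0 ;;
     For ''i'' ''k'' (RSet ''out'' [''l'', ''i''] 0) ;;
     For ''a'' ''mi'' (ILoad ''ca'' Coord_in [''l'', ''a''] ;; For ''b'' ''mo'' entry_prog)"

definition fact_prog :: "(layer_itab, layer_rtab) com" where
  "fact_prog = ILoad ''L'' Layers [] ;; For ''l'' ''L'' layer_prog"

text \<open>Two samples that agree after masking. Equal samples give correctness and cost; samples
  that differ outside the mask give independence of the trace from the unmasked entries.\<close>

locale masked_samples =
  fixes Fs :: "layer list" and T :: nat and z z' :: "nat \<Rightarrow> real mat \<times> real mat"
  assumes layers_valid: "layers_setup Fs" and T_pos: "0 < T"
    and samples: "z \<in> layer_samples Fs T" "z' \<in> layer_samples Fs T"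
    and same_in: "l < length Fs \<Longrightarrow>
      mask_rows (coords_in (Fs ! l)) (fst (z' l)) = mask_rows (coords_in (Fs ! l)) (fst (z l))"
    and same_out: "l < length Fs \<Longrightarrow>
      mask_rows (coords_out (Fs ! l)) (snd (z' l)) = mask_rows (coords_out (Fs ! l)) (snd (z l))"
begin

abbreviation "E \<equiv> layer_tables Fs T z"
abbreviation "E' \<equiv> layer_tables Fs T z'"
abbreviation "mi l \<equiv> length (coords_in (Fs ! l))"
abbreviation "mo l \<equiv> length (coords_out (Fs ! l))"

definition "xm l = mask_rows (coords_in (Fs ! l)) (fst (z l))"
definition "ym l = mask_rows (coords_out (Fs ! l)) (snd (z l))"
definition "hm l = layer_grad (xm l) (ym l)"

text \<open>All cells that may ever be written: two scalars and the outputs. No address involves a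
  sequence position, so the space bound is free of \<open>T\<close>.\<close>

definition "cells = {(''h'', []), (''p'', [])} \<union>
  (\<Union>l<length Fs. (\<lambda>i. (''out'', [l, i])) ` {..<layer_k (Fs ! l)})"

definition finished :: "nat \<Rightarrow> state \<Rightarrow> bool" where
  "finished l s \<longleftrightarrow> dom (mem s) \<subseteq> cells \<and> (\<forall>l'<l. \<forall>i<layer_k (Fs ! l').
     mem s (''out'', [l', i]) = Some (partial_prod (lproj (Fs ! l')) (hm l') (layer_mid (Fs ! l')) i))"

text \<open>Register \<open>j\<close> carries the flattened index \<open>a * mo l + b\<close>. It is
  maintained by increments because the machine cannot multiply registers, and \<open>one\<close> is
  there because \<open>IAdd\<close> takes only registers.\<close>

definition registers :: "nat \<Rightarrow> nat \<Rightarrow> state \<Rightarrow> bool" where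
  "registers l n s \<longleftrightarrow> ival s ''l'' = l \<and> ival s ''mi'' = mi l \<and> ival s ''mo'' = mo l \<and>
     ival s ''T'' = T \<and> ival s ''one'' = 1 \<and> ival s ''j'' = n"

definition in_layer :: "nat \<Rightarrow> nat \<Rightarrow> state \<Rightarrow> bool" where
  "in_layer l n s \<longleftrightarrow> finished l s \<and> registers l n s \<and>
     (\<forall>i<layer_k (Fs ! l). mem s (''out'', [l, i]) = Some (partial_prod (lproj (Fs ! l)) (hm l) n i))"

lemma layer_setup: "l < length Fs \<Longrightarrow> layer_setup (Fs ! l)"
  using layers_valid by (simp add: layers_setup_def)

lemma carriers:
  assumes "l < length Fs"
  shows "fst (z l) \<in> carrier_mat (d_in (Fs ! l)) T" "snd (z l) \<in> carrier_mat (d_out (Fs ! l)) T"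
    "fst (z' l) \<in> carrier_mat (d_in (Fs ! l)) T" "snd (z' l) \<in> carrier_mat (d_out (Fs ! l)) T"
  using assms samples by (simp_all add: layer_samples_def)

lemma lproj: "l < length Fs \<Longrightarrow> lproj (Fs ! l) \<in> sjlt_matrices (layer_k (Fs ! l)) (layer_mid (Fs ! l))"
  using layer_setup[of l] set_pmf_SJLT[of "layer_k (Fs ! l)" "layer_mid (Fs ! l)"]
  by (simp add: layer_setup_def layer_k_def)

lemma coord_in: "l < length Fs \<Longrightarrow> a < mi l \<Longrightarrow> coords_in (Fs ! l) ! a < d_in (Fs ! l)"
  and coord_out: "l < length Fs \<Longrightarrow> b < mo l \<Longrightarrow> coords_out (Fs ! l) ! b < d_out (Fs ! l)"
  using layer_setup[of l] by (auto simp: layer_setup_def intro: is_mask_nth)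

lemma itab_same: "itab E = itab E'"
  by (simp add: layer_tables_def)

lemma rtab_LSign: "rtab E' LSign js = rtab E LSign js"
proof -
  have "layer_real Fs T z' LSign js = layer_real Fs T z LSign js"
    by (cases "(Fs, T, z, LSign, js)" rule: layer_real.cases) auto
  then show ?thesis by (simp add: layer_tables_def)
qed

text \<open>Sample data are read only at masked coordinates, and there \<open>same_in\<close> makes
  the two tables agree. This is where the independence from unmasked inputs enters.\<close>

lemma rtab_X:
  assumes "l < length Fs" "a < mi l" "t < T"
  shows "rtab E X_in [l, coords_in (Fs ! l) ! a, t] = xm l $$ (a, t)"
    and "rtab E' X_in [l, coords_in (Fs ! l) ! a, t] = xm l $$ (a, t)"
  using assms coord_in mask_rows_index[OF carriers(1)[OF assms(1)] assms(2,3)]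
    mask_rows_index[OF carriers(3)[OF assms(1)] assms(2,3)] same_in[OF assms(1)]
  by (simp_all add: layer_tables_def xm_def)

lemma rtab_Y:
  assumes "l < length Fs" "b < mo l" "t < T"
  shows "rtab E Y_out [l, coords_out (Fs ! l) ! b, t] = ym l $$ (b, t)"
    and "rtab E' Y_out [l, coords_out (Fs ! l) ! b, t] = ym l $$ (b, t)"
  using assms coord_out mask_rows_index[OF carriers(2)[OF assms(1)] assms(2,3)]
    mask_rows_index[OF carriers(4)[OF assms(1)] assms(2,3)] same_out[OF assms(1)]
  by (simp_all add: layer_tables_def ym_def)

lemma hm_index:
  assumes "l < length Fs" "a < mi l" "b < mo l"
  shows "hm l $ (a * mo l + b) = (\<Sum>t<T. xm l $$ (a, t) * ym l $$ (b, t))"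
  unfolding hm_def xm_def ym_def
  by (rule layer_grad_index[OF carriers(1,2)[OF assms(1), THEN mask_rows_carrier] assms(2,3)])

lemma FactGraSS_index:
  assumes "l < length Fs" "i < layer_k (Fs ! l)"
  shows "FactGraSS (Fs ! l) (fst (z l)) (snd (z l)) $ i =
    partial_prod (lproj (Fs ! l)) (hm l) (layer_mid (Fs ! l)) i"
  unfolding FactGraSS_def hm_def xm_def ym_def using assms
  by (intro mult_mat_vec_partial_prod[OF lproj]) (simp_all add: mask_rows_def layer_mid_def)

lemma entry_prog_runs:
  assumes l: "l < length Fs" and a: "a < mi l" and b: "b < mo l"
    and s: "in_layer l (a * mo l + b) s" "ival s ''ca'' = coords_in (Fs ! l) ! a"
  shows "runs E E' entry_prog (iwrite ''b'' b s)
    (1 + (1 + (1 + ((1 + T * (1 + (1 + 1))) + (1 + (1 + 1))))))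
    (\<lambda>s'. in_layer l (a * mo l + Suc b) s' \<and> ival s' ''ca'' = coords_in (Fs ! l) ! a)"
proof -
  let ?n = "a * mo l + b"
  have n: "?n < layer_mid (Fs ! l)"
    using pair_index_less[OF a b] by (simp add: layer_mid_def)
  \<comment> \<open>Along the sequence only the accumulator \<open>h\<close> advances; the outputs
    stay at stage \<open>?n\<close>.\<close>
  define H where "H t s \<longleftrightarrow> in_layer l ?n s \<and> ival s ''ca'' = coords_in (Fs ! l) ! a \<and>
    ival s ''cb'' = coords_out (Fs ! l) ! b \<and> ival s ''r'' = sjlt_row (lproj (Fs ! l)) ?n \<and>
    mem s (''h'', []) = Some (\<Sum>t'<t. xm l $$ (a, t') * ym l $$ (b, t'))" for t and s :: state
  have step: "runs E E'
      (RMul ''p'' [] (Input X_in [''l'', ''ca'', ''t'']) (Input Y_out [''l'', ''cb'', ''t'']) ;;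
        RAdd ''h'' [] (Cell ''h'' []) (Cell ''p'' [])) (iwrite ''t'' t s) (1 + 1) (H (Suc t))"
    if "t < T" "H t s" for t s
    using that rtab_X[OF l a that(1)] rtab_Y[OF l b that(1)]
    by (intro runs_Seq runs_RMul runs_RAdd)
       (auto simp: H_def in_layer_def registers_def finished_def cells_def)
  have loop: "runs E E' (For ''t'' ''T''
      (RMul ''p'' [] (Input X_in [''l'', ''ca'', ''t'']) (Input Y_out [''l'', ''cb'', ''t'']) ;;
        RAdd ''h'' [] (Cell ''h'' []) (Cell ''p'' []))) s (1 + T * (1 + (1 + 1))) (H T)"
    if "H 0 s" for s
    using that by (intro runs_For_const step) (auto simp: H_def in_layer_def registers_def)
  \<comment> \<open>After the loop \<open>h\<close> holds entry \<open>?n\<close> of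
    \<open>hm l\<close>; its signed addition to one output cell is the step
    \<open>partial_prod_Suc\<close>, and incrementing \<open>j\<close> restores the invariant for
    \<open>Suc b\<close>.\<close>
  have project: "runs E E'
      (RMul ''h'' [] (Cell ''h'' []) (Input LSign [''l'', ''j'']) ;;
       RAdd ''out'' [''l'', ''r''] (Cell ''out'' [''l'', ''r'']) (Cell ''h'' []) ;;
       IAdd ''j'' ''j'' ''one'') s (1 + (1 + 1))
      (\<lambda>s'. in_layer l (a * mo l + Suc b) s' \<and> ival s' ''ca'' = coords_in (Fs ! l) ! a)"
    if "H T s" for s
  proof -
    have sign: "rtab E LSign [l, ?n] = sjlt_sign (lproj (Fs ! l)) ?n"
      using l n by (simp add: layer_tables_def Let_def)
    have row: "sjlt_row (lproj (Fs ! l)) ?n < layer_k (Fs ! l)"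
      by (rule sjlt_entries(1)[OF lproj[OF l] n])
    show ?thesis
      using that l row
      by (intro runs_Seq runs_RMul runs_RAdd runs_IAdd)
         (auto simp: H_def in_layer_def registers_def finished_def cells_def rtab_LSign sign
           partial_prod_Suc[OF lproj[OF l] n] hm_index[OF l a b])
  qed
  have row: "itab E LRow [l, ?n] = sjlt_row (lproj (Fs ! l)) ?n"
    using l n by (simp add: layer_tables_def Let_def)
  have coord: "itab E Coord_out [l, b] = coords_out (Fs ! l) ! b"
    using l b by (simp add: layer_tables_def Let_def)
  show ?thesis
    unfolding entry_prog_def using s
    by (intro runs_Seq runs_ILoad[OF itab_same] runs_RSet runs_weaken[OF loop order_refl project])
       (auto simp: H_def in_layer_def registers_def finished_def cells_def row coord)
qed

lemma layer_prog_runs: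
  assumes l: "l < length Fs" and s: "finished l s"
  shows "runs E E' layer_prog (iwrite ''l'' l s) (25 * T * layer_mid (Fs ! l)) (finished (Suc l))"
proof -
  let ?N = "1 + (1 + (1 + ((1 + T * (1 + (1 + 1))) + (1 + (1 + 1)))))"
  define Z where "Z n s \<longleftrightarrow> finished l s \<and> registers l 0 s \<and>
    (\<forall>i<n. mem s (''out'', [l, i]) = Some 0)" for n and s :: state
  have zero: "runs E E' (RSet ''out'' [''l'', ''i''] 0) (iwrite ''i'' n s) 1 (Z (Suc n))"
    if "n < layer_k (Fs ! l)" "Z n s" for n s
    using that l
    by (intro runs_RSet) (auto simp: Z_def registers_def finished_def cells_def less_Suc_eq)
  have zeros: "runs E E' (For ''i'' ''k'' (RSet ''out'' [''l'', ''i''] 0)) s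
      (1 + layer_k (Fs ! l) * (1 + 1)) (Z (layer_k (Fs ! l)))"
    if "ival s ''k'' = layer_k (Fs ! l)" "Z 0 s" for s
    using that zero by (rule runs_For_const)
  have inner: "runs E E' (For ''b'' ''mo'' entry_prog) s (1 + mo l * (1 + ?N)) (in_layer l (Suc a * mo l))"
    if a: "a < mi l" and s: "in_layer l (a * mo l) s" "ival s ''ca'' = coords_in (Fs ! l) ! a" for a s
  proof -
    have "runs E E' (For ''b'' ''mo'' entry_prog) s (1 + mo l * (1 + ?N))
      ((\<lambda>b s. in_layer l (a * mo l + b) s \<and> ival s ''ca'' = coords_in (Fs ! l) ! a) (mo l))"
      using s by (intro runs_For_const entry_prog_runs[OF l a]) (auto simp: in_layer_def registers_def)
    then show ?thesis
      \<comment> \<open>The end of row \<open>a\<close>, at \<open>a * mo l + mo l\<close>, is the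
        start of row \<open>Suc a\<close>.\<close>
      by (rule runs_weaken) (simp_all add: add.commute)
  qed
  have row: "runs E E' (ILoad ''ca'' Coord_in [''l'', ''a''] ;; For ''b'' ''mo'' entry_prog)
      (iwrite ''a'' a s) (1 + (1 + mo l * (1 + ?N))) (in_layer l (Suc a * mo l))"
    if a: "a < mi l" and s: "in_layer l (a * mo l) s" for a s
    using s l a
    by (intro runs_Seq runs_ILoad[OF itab_same] inner)
       (auto simp: in_layer_def registers_def finished_def layer_tables_def Let_def)
  have outer: "runs E E' (For ''a'' ''mi'' (ILoad ''ca'' Coord_in [''l'', ''a''] ;; For ''b'' ''mo'' entry_prog)) s
      (1 + mi l * (1 + (1 + (1 + mo l * (1 + ?N))))) (finished (Suc l))"
    if "Z (layer_k (Fs ! l)) s" for s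
  proof (rule runs_weaken[OF _ order_refl])
    show "runs E E' (For ''a'' ''mi'' (ILoad ''ca'' Coord_in [''l'', ''a''] ;; For ''b'' ''mo'' entry_prog)) s
      (1 + mi l * (1 + (1 + (1 + mo l * (1 + ?N))))) ((\<lambda>a. in_layer l (a * mo l)) (mi l))"
      using that by (intro runs_For_const row) (auto simp: Z_def in_layer_def registers_def)
    \<comment> \<open>At \<open>mi l * mo l = layer_mid (Fs ! l)\<close> every column has been
      consumed, so the partial product of layer \<open>l\<close> is complete.\<close>
    show "finished (Suc l) s'" if "in_layer l (mi l * mo l) s'" for s'
      using that by (auto simp: in_layer_def finished_def less_Suc_eq layer_mid_def)
  qed
  have "runs E E' layer_prog (iwrite ''l'' l s)
    (1 + (1 + (1 + (1 + (1 + (1 + ((1 + layer_k (Fs ! l) * (1 + 1)) +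
      (1 + mi l * (1 + (1 + (1 + mo l * (1 + ?N)))))))))))) (finished (Suc l))"
    unfolding layer_prog_def using l s
    by (intro runs_Seq runs_ILoad[OF itab_same] runs_ISet runs_weaken[OF zeros order_refl outer])
       (auto simp: Z_def registers_def finished_def layer_tables_def Let_def)
  then show ?thesis
  proof (rule runs_weaken)
    have pos: "0 < mi l" "0 < mo l" "layer_k (Fs ! l) \<le> layer_mid (Fs ! l)"
      using layer_setup[OF l] by (auto simp: layer_setup_def layer_k_def layer_mid_def mult_le_mono)
    \<comment> \<open>With \<open>k = layer_k (Fs ! l)\<close> the count is 8 + 2k + 3 mi + 8M + 3P.
      As k, mi and 1 are at most M, and M is at most P, it is at most 24P.\<close>
    define M where "M = layer_mid (Fs ! l)"
    define P where "P = T * M"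
    have "mi l * (mo l * T) = P" "mi l * mo l = M" "25 * T * M = 25 * P"
      by (simp_all add: P_def M_def layer_mid_def)
    moreover have "mi l \<le> M" "M \<le> P" "0 < M" "layer_k (Fs ! l) \<le> M"
      using pos T_pos by (simp_all add: P_def M_def layer_mid_def Suc_le_eq)
    ultimately show "1 + (1 + (1 + (1 + (1 + (1 + ((1 + layer_k (Fs ! l) * (1 + 1)) +
      (1 + mi l * (1 + (1 + (1 + mo l * (1 + ?N))))))))))) \<le> 25 * T * layer_mid (Fs ! l)"
      unfolding M_def[symmetric] by (simp add: algebra_simps)
  qed
qed

lemma fact_prog_runs:
  "runs E E' fact_prog start (28 * T * total_mid Fs) (finished (length Fs))"
proof -
  have "runs E E' fact_prog start (1 + (1 + (\<Sum>l<length Fs. 1 + 25 * T * layer_mid (Fs ! l))))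
    (finished (length Fs))"
    unfolding fact_prog_def
    by (intro runs_Seq runs_ILoad[OF itab_same] runs_For layer_prog_runs)
       (auto simp: finished_def start_def layer_tables_def Let_def)
  then show ?thesis
  proof (rule runs_weaken)
    have mid: "total_mid Fs = (\<Sum>l<length Fs. layer_mid (Fs ! l))"
      by (simp add: total_mid_def sum_list_sum_nth atLeast0LessThan)
    \<comment> \<open>Nonzero intermediate dimensions bound the number of layers by
      \<open>total_mid Fs\<close>, which absorbs the overhead per layer. The total 2 + L + 25P, for
      L layers, is then at most 28P.\<close>
    have "1 \<le> layer_mid (Fs ! l)" if "l < length Fs" for l
      using layer_setup[OF that] by (auto simp: layer_setup_def layer_mid_def Suc_le_eq)
    then have "length Fs \<le> total_mid Fs"
      using sum_mono[of "{..<length Fs}" "\<lambda>_. 1" "\<lambda>l. layer_mid (Fs ! l)"] by (simp add: mid)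
    moreover have "1 \<le> length Fs" using layers_valid by (simp add: layers_setup_def Suc_le_eq)
    moreover define P where "P = T * total_mid Fs"
    moreover have "total_mid Fs \<le> P" using T_pos by (simp add: P_def)
    moreover have "(\<Sum>l<length Fs. 1 + 25 * T * layer_mid (Fs ! l)) = length Fs + 25 * P"
      unfolding P_def mid sum.distrib sum_distrib_left by (simp add: mult.assoc)
    moreover have "28 * T * total_mid Fs = 28 * P" by (simp add: P_def)
    ultimately show "1 + (1 + (\<Sum>l<length Fs. 1 + 25 * T * layer_mid (Fs ! l))) \<le> 28 * T * total_mid Fs"
      by linarith
  qed
qed

lemma card_cells: "finite cells" "card cells \<le> 2 + total_mid Fs"
proof -
  show "finite cells" by (simp add: cells_def)
  have "card (\<Union>l<length Fs. (\<lambda>i. (''out'', [l, i])) ` {..<layer_k (Fs ! l)}) \<le>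
    (\<Sum>l<length Fs. card ((\<lambda>i. (''out'', [l, i])) ` {..<layer_k (Fs ! l)}))"
    by (rule card_UN_le) simp
  also have "\<dots> \<le> (\<Sum>l<length Fs. layer_mid (Fs ! l))"
  proof (rule sum_mono)
    fix l assume "l \<in> {..<length Fs}"
    then have "layer_k (Fs ! l) \<le> layer_mid (Fs ! l)"
      using layer_setup[of l] by (simp add: layer_setup_def layer_k_def layer_mid_def mult_le_mono)
    then show "card ((\<lambda>i. (''out'', [l, i])) ` {..<layer_k (Fs ! l)}) \<le> layer_mid (Fs ! l)"
      using card_image_le[of "{..<layer_k (Fs ! l)}" "\<lambda>i. (''out'', [l, i])"] by simp
  qed
  also have "\<dots> = total_mid Fs"
    by (simp add: total_mid_def sum_list_sum_nth atLeast0LessThan)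
  finally show "card cells \<le> 2 + total_mid Fs"
    unfolding cells_def by (intro order_trans[OF card_Un_le] add_mono) simp_all
qed

end

lemma masked_samples_refl:
  "layers_setup Fs \<Longrightarrow> 0 < T \<Longrightarrow> z \<in> layer_samples Fs T \<Longrightarrow> masked_samples Fs T z z"
  by (simp add: masked_samples_def)

text \<open>A coordinate \<open>i\<close> outside the mask leaves the trace unchanged, but the first entry of the \<open>i\<close>-th
  block of the full gradient depends on it.\<close>

lemma fact_prog_not_materializes:
  assumes Fs: "layers_setup Fs" and T: "0 < T" and l: "l < length Fs"
  shows "\<not> materializes fact_prog (layer_tables Fs T) (layer_samples Fs T)
    (layer_p (Fs ! l)) (\<lambda>z. layer_grad (fst (z l)) (snd (z l)))"
proof
  let ?F = "Fs ! l"
  assume "materializes fact_prog (layer_tables Fs T) (layer_samples Fs T)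
    (layer_p ?F) (\<lambda>z. layer_grad (fst (z l)) (snd (z l)))"
  then obtain n \<sigma> where mat: "\<And>z j. z \<in> layer_samples Fs T \<Longrightarrow> j < layer_p ?F \<Longrightarrow>
      mem (trace fact_prog (layer_tables Fs T z) ! n) (\<sigma> j) = Some (layer_grad (fst (z l)) (snd (z l)) $ j)"
    unfolding materializes_def by blast
  have "layer_setup ?F" using Fs l by (simp add: layers_setup_def)
  then have F: "length (coords_in ?F) < d_in ?F" "0 < d_out ?F"
    by (auto simp: layer_setup_def)
  have "card (set (coords_in ?F)) < card {..<d_in ?F}"
    using F(1) card_length[of "coords_in ?F"] by simp
  then have "\<not> {..<d_in ?F} \<subseteq> set (coords_in ?F)"
    using card_mono[of "set (coords_in ?F)" "{..<d_in ?F}"] by auto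
  \<comment> \<open>The mask is too short to list every input coordinate.\<close>
  then obtain i where i: "i < d_in ?F" "i \<notin> set (coords_in ?F)"
    by blast
  \<comment> \<open>The samples vary only in row \<open>i\<close> of the input of layer
    \<open>l\<close>, so their masked factors do not depend on \<open>c\<close>. The constant 1 in
    the other factor lets \<open>c\<close> show up in the gradient.\<close>
  define z where "z c l' = (mat (d_in (Fs ! l')) T (\<lambda>(i', t). if l' = l \<and> i' = i then c else 0),
    mat (d_out (Fs ! l')) T (\<lambda>_. 1) :: real mat)" for c :: real and l'
  have z: "z c \<in> layer_samples Fs T" for c
    by (simp add: layer_samples_def z_def)
  have nth_neq: "coords_in ?F ! j \<noteq> i" if "j < length (coords_in ?F)" for j
    using i(2) nth_mem[OF that] by auto
  have coord: "coords_in (Fs ! l') ! j < d_in (Fs ! l')"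
    if "l' < length Fs" "j < length (coords_in (Fs ! l'))" for l' j
    using Fs that by (auto simp: layers_setup_def layer_setup_def intro: is_mask_nth)
  interpret masked_samples Fs T "z 0" "z 1"
  proof
    show "mask_rows (coords_in (Fs ! l')) (fst (z 1 l')) = mask_rows (coords_in (Fs ! l')) (fst (z 0 l'))"
      if "l' < length Fs" for l'
      using nth_neq coord[OF that] by (intro eq_matI) (auto simp: mask_rows_def z_def)
  qed (use Fs T z in \<open>simp_all add: z_def\<close>)
  have same: "trace fact_prog E = trace fact_prog E'"
    using fact_prog_runs by (simp add: runs_def)
  \<comment> \<open>The pair (i, 0); the summand 0 keeps the form required by
    \<open>layer_grad_index\<close>.\<close>
  define r where "r = i * d_out ?F + 0"
  have r: "r < layer_p ?F"
    using pair_index_less[OF i(1) F(2)] by (simp add: r_def layer_p_def)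
  have "layer_grad (fst (z c l)) (snd (z c l)) $ r = real T * c" for c
  proof -
    have "layer_grad (fst (z c l)) (snd (z c l)) $ r = (\<Sum>t<T. fst (z c l) $$ (i, t) * snd (z c l) $$ (0, t))"
      unfolding r_def using i(1) F(2) by (intro layer_grad_index) (simp_all add: z_def)
    then show ?thesis using i(1) F(2) by (simp add: z_def)
  qed
  \<comment> \<open>With identical traces, cell \<open>\<sigma> r\<close> at step \<open>n\<close>
    would hold both 0 and \<open>real T\<close>, against \<open>0 < T\<close>.\<close>
  then show False
    using mat[OF z r, of 0] mat[OF z r, of 1] same T by simp
qed

section \<open>Uniform constants and sublinear growth\<close>

lemma smallo_of_linear_bound:
  assumes "\<And>n. f n \<le> C * m n" "(\<lambda>n. real (m n)) \<in> o(p)"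
  shows "(\<lambda>n. real (f n)) \<in> o(p)"
proof -
  \<comment> \<open>\<open>C\<close> is the same for the whole family, so the pointwise bound is a
    big-O bound.\<close>
  have "(\<lambda>n. real (f n)) \<in> O(\<lambda>n. real (m n))"
    using assms(1) by (intro bigoI[where c = "real C"] always_eventually)
      (simp flip: of_nat_mult)
  then show ?thesis using assms(2) by (rule landau_o.big_small_trans)
qed

text \<open>The constant precedes all dimensions and samples; this is possible because the register
  set \<open>R\<close> depends on the program alone.\<close>

lemma grass_prog_bounds:
  "\<exists>C. \<forall>G g. grass_setup G \<longrightarrow> outputs grass_prog (grass_tables G g) [] (GraSS G g) \<and>
     run_time grass_prog (grass_tables G g) \<le> C * mid_dim G \<and>
     run_space grass_prog (grass_tables G g) \<le> C * mid_dim G"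
proof -
  obtain R where R: "finite R" "\<And>E. dom (ireg (last (trace grass_prog E))) \<subseteq> R"
    using trace_regs_finite[of grass_prog] by blast
  show ?thesis
  \<comment> \<open>11 is the time constant; for space, \<open>card R\<close> counts registers and
    the 1 + \<open>out_dim G\<close> cells are at most \<open>mid_dim G\<close>.\<close>
  proof (intro exI[of _ "card R + 11"] allI impI conjI)
    fix G :: grass and g :: "real vec"
    assume G: "grass_setup G"
    let ?E = "grass_tables G g"
    let ?M = "insert (''h'', []) ((\<lambda>i. (''out'', [i])) ` {..<out_dim G})"
    have dims: "0 < mid_dim G" "out_dim G < mid_dim G" "dim_row (proj G) = out_dim G"
      using G grass_setup_proj[OF G] by (auto simp: grass_setup_def sjlt_matrices_def)
    note runs = grass_prog_runs[OF G, of g, unfolded runs_def]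
    show "outputs grass_prog ?E [] (GraSS G g)"
      using runs dims(3) by (simp add: outputs_def GraSS_def)
    have "run_time grass_prog ?E \<le> 11 * mid_dim G"
      using runs by (simp add: run_time_def)
    also have "\<dots> \<le> (card R + 11) * mid_dim G" by simp
    finally show "run_time grass_prog ?E \<le> (card R + 11) * mid_dim G" .
    have "run_space grass_prog ?E \<le> card R + card ?M"
      using runs R by (intro run_space_le) auto
    also have "card ?M \<le> 1 + out_dim G"
      by (intro order_trans[OF card_insert_le_m1]) (auto intro: order_trans[OF card_image_le])
    also have "card R + (1 + out_dim G) \<le> card R * mid_dim G + 11 * mid_dim G"
      using dims by (intro add_mono) simp_all
    finally show "run_space grass_prog ?E \<le> (card R + 11) * mid_dim G"
      by (simp add: add_mult_distrib)
  qed
qed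

lemma fact_prog_bounds:
  "\<exists>C. \<forall>Fs T z. layers_setup Fs \<longrightarrow> 0 < T \<longrightarrow> z \<in> layer_samples Fs T \<longrightarrow>
     (\<forall>l<length Fs.
       outputs fact_prog (layer_tables Fs T z) [l] (FactGraSS (Fs ! l) (fst (z l)) (snd (z l)))) \<and>
     run_time fact_prog (layer_tables Fs T z) \<le> C * T * total_mid Fs \<and>
     run_space fact_prog (layer_tables Fs T z) \<le> C * total_mid Fs"
proof -
  obtain R where R: "finite R" "\<And>E. dom (ireg (last (trace fact_prog E))) \<subseteq> R"
    using trace_regs_finite[of fact_prog] by blast
  show ?thesis
  \<comment> \<open>28 is the time constant; it also covers the at most 2 +
    \<open>total_mid Fs\<close> cells, because \<open>total_mid Fs\<close> is positive.\<close>
  proof (intro exI[of _ "card R + 28"] allI impI conjI)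
    fix Fs :: "layer list" and T :: nat and z :: "nat \<Rightarrow> real mat \<times> real mat"
    assume hyps: "layers_setup Fs" "0 < T" "z \<in> layer_samples Fs T"
    interpret masked_samples Fs T z z
      using hyps by (rule masked_samples_refl)
    note runs = fact_prog_runs[unfolded runs_def]
    show "outputs fact_prog E [l] (FactGraSS (Fs ! l) (fst (z l)) (snd (z l)))" if l: "l < length Fs" for l
    proof -
      have "dim_vec (FactGraSS (Fs ! l) (fst (z l)) (snd (z l))) = layer_k (Fs ! l)"
        using lproj[OF l] by (auto simp: FactGraSS_def sjlt_matrices_def)
      then show ?thesis
        using runs l FactGraSS_index[OF l] by (simp add: outputs_def finished_def)
    qed
    have "run_time fact_prog E \<le> 28 * (T * total_mid Fs)"
      using runs by (simp add: run_time_def)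
    also have "\<dots> \<le> (card R + 28) * (T * total_mid Fs)" by (rule mult_le_mono1) simp
    finally show "run_time fact_prog E \<le> (card R + 28) * T * total_mid Fs"
      by (simp only: mult.assoc)
    have "0 < total_mid Fs"
      using layers_valid layer_setup[of 0]
      by (cases Fs) (auto simp: layers_setup_def total_mid_def layer_setup_def layer_mid_def)
    have "run_space fact_prog E \<le> card R + card cells"
      using runs R card_cells(1) by (intro run_space_le) (simp_all add: finished_def)
    also have "\<dots> \<le> card R * total_mid Fs + 28 * total_mid Fs"
      using card_cells(2) \<open>0 < total_mid Fs\<close> by (intro add_mono) simp_all
    finally show "run_space fact_prog E \<le> (card R + 28) * total_mid Fs"
      by (simp add: add_mult_distrib)
  qed
qed

theorem theorem3p2:
  shows
    "(\<exists>(P :: (grass_itab, grass_rtab) com) (C :: nat).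
        (\<forall>G. grass_setup G \<longrightarrow>
          (\<forall>g \<in> carrier_vec (param_dim G).
             GraSS G g \<in> carrier_vec (out_dim G) \<and>
             outputs P (grass_tables G g) [] (GraSS G g) \<and>
             run_time P (grass_tables G g) \<le> C * mid_dim G \<and>
             run_space P (grass_tables G g) \<le> C * mid_dim G)) \<and>
        (\<forall>(G :: nat \<Rightarrow> grass) g.
          (\<forall>n. grass_setup (G n) \<and> g n \<in> carrier_vec (param_dim (G n))) \<longrightarrow>
          (\<lambda>n. real (mid_dim (G n))) \<in> o(\<lambda>n. real (param_dim (G n))) \<longrightarrow>
          (\<lambda>n. real (run_time P (grass_tables (G n) (g n)))) \<in> o(\<lambda>n. real (param_dim (G n))) \<and>
          (\<lambda>n. real (run_space P (grass_tables (G n) (g n)))) \<in> o(\<lambda>n. real (param_dim (G n))))) \<and>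
     (\<exists>(P :: (layer_itab, layer_rtab) com) (C :: nat).
        (\<forall>Fs T. layers_setup Fs \<longrightarrow> 0 < T \<longrightarrow>
          (\<forall>z \<in> layer_samples Fs T.
             (\<forall>l<length Fs.
                let F = Fs ! l; X = fst (z l); Y = snd (z l) in
                layer_grad X Y \<in> carrier_vec (layer_p F) \<and>
                FactGraSS F X Y \<in> carrier_vec (layer_k F) \<and>
                FactGraSS F X Y =
                  lproj F *\<^sub>v Mask (kron_mask (coords_in F) (coords_out F) (d_out F)) (layer_grad X Y) \<and>
                outputs P (layer_tables Fs T z) [l] (FactGraSS F X Y)) \<and>
             run_time P (layer_tables Fs T z) \<le> C * T * total_mid Fs \<and>
             run_space P (layer_tables Fs T z) \<le> C * total_mid Fs) \<and>
          (\<forall>l<length Fs. \<not> materializes P (layer_tables Fs T) (layer_samples Fs T)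
             (layer_p (Fs ! l)) (\<lambda>z. layer_grad (fst (z l)) (snd (z l))))) \<and>
        (\<forall>(Fs :: nat \<Rightarrow> layer list) T z. 0 < T \<longrightarrow>
          (\<forall>n. layers_setup (Fs n) \<and> z n \<in> layer_samples (Fs n) T) \<longrightarrow>
          (\<lambda>n. real (total_mid (Fs n))) \<in> o(\<lambda>n. real (total_p (Fs n))) \<longrightarrow>
          (\<lambda>n. real (run_time P (layer_tables (Fs n) T (z n)))) \<in> o(\<lambda>n. real (total_p (Fs n))) \<and>
          (\<lambda>n. real (run_space P (layer_tables (Fs n) T (z n)))) \<in> o(\<lambda>n. real (total_p (Fs n)))))"
proof (rule conjI)
  obtain C where C: "\<And>G g. grass_setup G \<Longrightarrow> outputs grass_prog (grass_tables G g) [] (GraSS G g)"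
    "\<And>G g. grass_setup G \<Longrightarrow> run_time grass_prog (grass_tables G g) \<le> C * mid_dim G"
    "\<And>G g. grass_setup G \<Longrightarrow> run_space grass_prog (grass_tables G g) \<le> C * mid_dim G"
    using grass_prog_bounds by metis
  show "\<exists>(P :: (grass_itab, grass_rtab) com) (C :: nat).
        (\<forall>G. grass_setup G \<longrightarrow>
          (\<forall>g \<in> carrier_vec (param_dim G).
             GraSS G g \<in> carrier_vec (out_dim G) \<and>
             outputs P (grass_tables G g) [] (GraSS G g) \<and>
             run_time P (grass_tables G g) \<le> C * mid_dim G \<and>
             run_space P (grass_tables G g) \<le> C * mid_dim G)) \<and>
        (\<forall>(G :: nat \<Rightarrow> grass) g.
          (\<forall>n. grass_setup (G n) \<and> g n \<in> carrier_vec (param_dim (G n))) \<longrightarrow>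
          (\<lambda>n. real (mid_dim (G n))) \<in> o(\<lambda>n. real (param_dim (G n))) \<longrightarrow>
          (\<lambda>n. real (run_time P (grass_tables (G n) (g n)))) \<in> o(\<lambda>n. real (param_dim (G n))) \<and>
          (\<lambda>n. real (run_space P (grass_tables (G n) (g n)))) \<in> o(\<lambda>n. real (param_dim (G n))))"
  proof (intro exI[of _ grass_prog] exI[of _ C] conjI allI impI ballI C GraSS_carrier)
    fix G :: "nat \<Rightarrow> grass" and g :: "nat \<Rightarrow> real vec"
    assume G: "\<forall>n. grass_setup (G n) \<and> g n \<in> carrier_vec (param_dim (G n))"
      and o: "(\<lambda>n. real (mid_dim (G n))) \<in> o(\<lambda>n. real (param_dim (G n)))"
    show "(\<lambda>n. real (run_time grass_prog (grass_tables (G n) (g n)))) \<in> o(\<lambda>n. real (param_dim (G n)))"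
      "(\<lambda>n. real (run_space grass_prog (grass_tables (G n) (g n)))) \<in> o(\<lambda>n. real (param_dim (G n)))"
      using G by (auto intro!: smallo_of_linear_bound[OF _ o] C)
  qed
next
  obtain C where C: "\<And>Fs T z l. layers_setup Fs \<Longrightarrow> 0 < T \<Longrightarrow> z \<in> layer_samples Fs T \<Longrightarrow> l < length Fs \<Longrightarrow>
      outputs fact_prog (layer_tables Fs T z) [l] (FactGraSS (Fs ! l) (fst (z l)) (snd (z l)))"
    "\<And>Fs T z. layers_setup Fs \<Longrightarrow> 0 < T \<Longrightarrow> z \<in> layer_samples Fs T \<Longrightarrow>
      run_time fact_prog (layer_tables Fs T z) \<le> C * T * total_mid Fs"
    "\<And>Fs T z. layers_setup Fs \<Longrightarrow> 0 < T \<Longrightarrow> z \<in> layer_samples Fs T \<Longrightarrow>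
      run_space fact_prog (layer_tables Fs T z) \<le> C * total_mid Fs"
    using fact_prog_bounds by (elim exE) (rule that; blast)
  have per_layer: "let F = Fs ! l; X = fst (z l); Y = snd (z l) in
      layer_grad X Y \<in> carrier_vec (layer_p F) \<and>
      FactGraSS F X Y \<in> carrier_vec (layer_k F) \<and>
      FactGraSS F X Y =
        lproj F *\<^sub>v Mask (kron_mask (coords_in F) (coords_out F) (d_out F)) (layer_grad X Y) \<and>
      outputs fact_prog (layer_tables Fs T z) [l] (FactGraSS F X Y)"
    if "layers_setup Fs" "0 < T" "z \<in> layer_samples Fs T" "l < length Fs" for Fs T z l
  proof -
    interpret masked_samples Fs T z z
      using that(1-3) by (rule masked_samples_refl)
    have "layer_grad (fst (z l)) (snd (z l)) \<in> carrier_vec (layer_p (Fs ! l))"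
      using carriers[OF that(4)] by (intro carrier_vecI) (auto simp: layer_p_def)
    moreover have "FactGraSS (Fs ! l) (fst (z l)) (snd (z l)) \<in> carrier_vec (layer_k (Fs ! l))"
      using lproj[OF that(4)] by (intro carrier_vecI) (auto simp: FactGraSS_def sjlt_matrices_def)
    \<comment> \<open>This identifies \<open>FactGraSS\<close> as a sparse projection after a
      product mask of the full gradient, although the program only touches the factors.\<close>
    moreover have "layer_grad (mask_rows (coords_in (Fs ! l)) (fst (z l))) (mask_rows (coords_out (Fs ! l)) (snd (z l))) =
      Mask (kron_mask (coords_in (Fs ! l)) (coords_out (Fs ! l)) (d_out (Fs ! l)))
        (layer_grad (fst (z l)) (snd (z l)))"
      using layer_setup[OF that(4)]
      by (intro layer_grad_mask_rows[OF carriers(1,2)[OF that(4)]]) (simp_all add: layer_setup_def)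
    ultimately show ?thesis
      using C(1)[OF that] unfolding Let_def FactGraSS_def by metis
  qed
  show "\<exists>(P :: (layer_itab, layer_rtab) com) (C :: nat).
        (\<forall>Fs T. layers_setup Fs \<longrightarrow> 0 < T \<longrightarrow>
          (\<forall>z \<in> layer_samples Fs T.
             (\<forall>l<length Fs.
                let F = Fs ! l; X = fst (z l); Y = snd (z l) in
                layer_grad X Y \<in> carrier_vec (layer_p F) \<and>
                FactGraSS F X Y \<in> carrier_vec (layer_k F) \<and>
                FactGraSS F X Y =
                  lproj F *\<^sub>v Mask (kron_mask (coords_in F) (coords_out F) (d_out F)) (layer_grad X Y) \<and>
                outputs P (layer_tables Fs T z) [l] (FactGraSS F X Y)) \<and>
             run_time P (layer_tables Fs T z) \<le> C * T * total_mid Fs \<and>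
             run_space P (layer_tables Fs T z) \<le> C * total_mid Fs) \<and>
          (\<forall>l<length Fs. \<not> materializes P (layer_tables Fs T) (layer_samples Fs T)
             (layer_p (Fs ! l)) (\<lambda>z. layer_grad (fst (z l)) (snd (z l))))) \<and>
        (\<forall>(Fs :: nat \<Rightarrow> layer list) T z. 0 < T \<longrightarrow>
          (\<forall>n. layers_setup (Fs n) \<and> z n \<in> layer_samples (Fs n) T) \<longrightarrow>
          (\<lambda>n. real (total_mid (Fs n))) \<in> o(\<lambda>n. real (total_p (Fs n))) \<longrightarrow>
          (\<lambda>n. real (run_time P (layer_tables (Fs n) T (z n)))) \<in> o(\<lambda>n. real (total_p (Fs n))) \<and>
          (\<lambda>n. real (run_space P (layer_tables (Fs n) T (z n)))) \<in> o(\<lambda>n. real (total_p (Fs n))))"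
  proof (intro exI[of _ fact_prog] exI[of _ C] conjI allI impI ballI C per_layer
      fact_prog_not_materializes)
    fix Fs :: "nat \<Rightarrow> layer list" and T :: nat and z :: "nat \<Rightarrow> nat \<Rightarrow> real mat \<times> real mat"
    assume T: "0 < T" and Fs: "\<forall>n. layers_setup (Fs n) \<and> z n \<in> layer_samples (Fs n) T"
      and o: "(\<lambda>n. real (total_mid (Fs n))) \<in> o(\<lambda>n. real (total_p (Fs n)))"
    show "(\<lambda>n. real (run_time fact_prog (layer_tables (Fs n) T (z n)))) \<in> o(\<lambda>n. real (total_p (Fs n)))"
      "(\<lambda>n. real (run_space fact_prog (layer_tables (Fs n) T (z n)))) \<in> o(\<lambda>n. real (total_p (Fs n)))"
      \<comment> \<open>The sequence length is fixed along the family, so \<open>C * T\<close>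
        serves as the constant for time.\<close>
      using T Fs by (auto intro!: smallo_of_linear_bound[OF _ o] C)
  qed
qed

end
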